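(* Let $K$ be an odd integer and let $m>1$ be an integer. Then: (1) if $m>3$, then $\omega_K(m)=4$ if and only if $\alpha_K(m)\equiv\pm1\pmod 4$; (2) $\omega_K(m)=2$ if and only if $4\mid\pi_K(m)$ and $2\mid\alpha_K(m)$; (3) $\omega_K(m)=1$ if and only if $4\nmid\pi_K(m)$.
   Context: For an integer $K$, the $K$-Fibonacci sequence is $F_{K,0}=0$, $F_{K,1}=1$, $F_{K,n}=KF_{K,n-1}+F_{K,n-2}$ for $n\ge2$. For an integer $m\ge 2$, $\pi_K(m)$ is the least positive period of $(F_{K,n}\bmod m)$, $\alpha_K(m)$ is the least positive index $n$ with $m\mid F_{K,n}$, and $\omega_K(m)$ is the number of indices $0\le n<\pi_K(m)$ with $m\mid F_{K,n}$. *)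

theory Defs
  imports "HOL-Number_Theory.Number_Theory"
begin

fun kfib :: "int \<Rightarrow> nat \<Rightarrow> int" where
  "kfib K 0 = 0"
| "kfib K (Suc 0) = 1"
| "kfib K (Suc (Suc n)) = K * kfib K (Suc n) + kfib K n"

(* The recurrence is invertible modulo m, so for m > 1 the sequence is purely periodic from
   index 0; hence the sets over which the two minima below are taken are nonempty. *)

definition kfib_period :: "int \<Rightarrow> int \<Rightarrow> nat" where
  "kfib_period K m = (LEAST p. p > 0 \<and> (\<forall>n. [kfib K (n + p) = kfib K n] (mod m)))"

definition kfib_rank :: "int \<Rightarrow> int \<Rightarrow> nat" where
  "kfib_rank K m = (LEAST n. n > 0 \<and> m dvd kfib K n)"

definition kfib_zeros :: "int \<Rightarrow> int \<Rightarrow> nat" where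
  "kfib_zeros K m = card {n. n < kfib_period K m \<and> m dvd kfib K n}"

end

theory Submission
  imports Defs
begin

text \<open>
  Write \<open>a\<close> for the rank and \<open>c\<close> for \<open>F (a + 1)\<close>. Shifting the sequence by \<open>a\<close> multiplies it by
  \<open>c\<close> modulo \<open>m\<close>, so the number of zeros in a period is the multiplicative order \<open>w\<close> of \<open>c\<close> and the
  period is \<open>a * w\<close>. Cassini's identity gives \<open>c\<^sup>2 \<equiv> (-1)^a\<close>, which settles everything except that
  \<open>w \<noteq> 1\<close> when \<open>a = 2 * k\<close> with \<open>k\<close> even. There \<open>c \<equiv> 1\<close> would make \<open>m\<close> divide both \<open>F k * L k\<close> and
  \<open>F k * L (k + 1)\<close>, where \<open>L\<close> is the companion Lucas sequence. Consecutive Lucas numbers have only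
  divisors of \<open>K\<^sup>2 + 4\<close> in common, and \<open>(L k)\<^sup>2 = (K\<^sup>2 + 4) * (F k)\<^sup>2 + 4\<close>, so for odd \<open>K\<close> they are
  coprime; thus \<open>m\<close> divides \<open>F k\<close>, contradicting the minimality of \<open>a\<close>.
\<close>

text \<open>The last factor is the term of index n - 1, written so that it also makes sense at n =
  0, where it equals 1. It is multiplied by \<open>kfib K p\<close>, so it drops out modulo any
  divisor of that term.\<close>

lemma kfib_add:
  "kfib K (n + p) = kfib K n * kfib K (Suc p) + kfib K p * (kfib K (Suc n) - K * kfib K n)"
  by (induction K n rule: kfib.induct) (simp_all add: algebra_simps)

lemma kfib_cassini:
  "(kfib K (Suc n))\<^sup>2 - K * kfib K n * kfib K (Suc n) - (kfib K n)\<^sup>2 = (- 1) ^ n"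
proof (induction n)
  case (Suc n)
  then show ?case by (simp add: power2_eq_square algebra_simps)
qed simp

lemma kfib_add_cong:
  assumes "m dvd kfib K p"
  shows "[kfib K (n + p) = kfib K n * kfib K (Suc p)] (mod m)"
  using assms by (simp add: kfib_add cong_iff_dvd_diff)

lemma kfib_mult_Suc_cong:
  assumes "m dvd kfib K a"
  shows "m dvd kfib K (j * a) \<and> [kfib K (Suc (j * a)) = kfib K (Suc a) ^ j] (mod m)"
proof (induction j)
  case (Suc j)
  have "[kfib K (j * a + a) = kfib K (j * a) * kfib K (Suc a)] (mod m)"
    using kfib_add_cong[OF assms] .
  then have 1: "m dvd kfib K (Suc j * a)"
    using Suc by (simp add: add.commute cong_dvd_iff)
  have "[kfib K (Suc (j * a) + a) = kfib K (Suc (j * a)) * kfib K (Suc a)] (mod m)"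
    using kfib_add_cong[OF assms] .
  also have "[kfib K (Suc (j * a)) * kfib K (Suc a) = kfib K (Suc a) ^ j * kfib K (Suc a)] (mod m)"
    using Suc by (intro cong_mult) auto
  finally show ?case using 1 by (simp add: ac_simps)
qed simp

lemma kfib_Suc_square_cong:
  assumes "m dvd kfib K a"
  shows "[(kfib K (Suc a))\<^sup>2 = (- 1) ^ a] (mod m)"
proof -
  have "(kfib K (Suc a))\<^sup>2 - (- 1) ^ a = kfib K a * (K * kfib K (Suc a) + kfib K a)"
    using kfib_cassini[of K a] by (simp add: power2_eq_square algebra_simps)
  then show ?thesis using assms by (simp add: cong_iff_dvd_diff)
qed

lemma coprime_kfib_Suc:
  assumes "m dvd kfib K a"
  shows "coprime (kfib K (Suc a)) m"
proof -
  have "coprime ((- 1) ^ a) m" by (cases "even a") auto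
  then have "coprime ((kfib K (Suc a))\<^sup>2) m"
    using kfib_Suc_square_cong[OF assms] cong_imp_coprime cong_sym by blast
  then show ?thesis by simp
qed

text \<open>The recurrence can be run backwards, so a repeated pair of consecutive terms descends to
  index 0, where the sequence vanishes.\<close>

lemma kfib_shift_down:
  assumes "[kfib K (i + d) = kfib K i] (mod m)" "[kfib K (Suc (i + d)) = kfib K (Suc i)] (mod m)"
  shows "[kfib K d = 0] (mod m)"
  using assms
proof (induction i)
  case (Suc i)
  have "[kfib K (Suc (Suc (i + d))) - K * kfib K (Suc (i + d))
       = kfib K (Suc (Suc i)) - K * kfib K (Suc i)] (mod m)"
    using Suc.prems by (intro cong_diff cong_mult) auto
  then show ?case using Suc by simp
qed simp

lemma kfib_zero_exists:
  assumes "m > 1"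
  shows "\<exists>n>0. m dvd kfib K n"
proof -
  \<comment> \<open>Pigeonhole on pairs of consecutive residues: only finitely many exist, so one
    repeats.\<close>
  let ?f = "\<lambda>n. (kfib K n mod m, kfib K (Suc n) mod m)"
  have "range ?f \<subseteq> {0..<m} \<times> {0..<m}" using assms by auto
  then have "finite (range ?f)" by (rule finite_subset) simp
  then have "\<not> inj ?f" using finite_imageD infinite_UNIV_nat by blast
  then obtain i j where "i < j" "?f j = ?f i"
    by (metis (no_types, lifting) injI linorder_neqE_nat)
  then have "[kfib K (i + (j - i)) = kfib K i] (mod m)"
    "[kfib K (Suc (i + (j - i))) = kfib K (Suc i)] (mod m)"
    by (auto simp: cong_def)
  then have "[kfib K (j - i) = 0] (mod m)" by (rule kfib_shift_down)
  then show ?thesis using \<open>i < j\<close> by (auto simp: cong_0_iff intro!: exI[of _ "j - i"])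
qed

lemma kfib_rank:
  assumes "m > 1"
  shows "kfib_rank K m > 0" "m dvd kfib K (kfib_rank K m)"
  using LeastI_ex[OF kfib_zero_exists[OF assms]] by (auto simp: kfib_rank_def)

text \<open>\<open>kfib K (Suc ?a)\<close> is a unit modulo m, so subtracting the rank from an index
  preserves zeros. Every zero thus descends to one below the rank, which can only be index
  0.\<close>

lemma dvd_kfib_iff:
  assumes "m > 1"
  shows "m dvd kfib K n \<longleftrightarrow> kfib_rank K m dvd n"
proof
  let ?a = "kfib_rank K m"
  have a: "?a > 0" "m dvd kfib K ?a" using kfib_rank[OF assms] by auto
  show "?a dvd n" if "m dvd kfib K n"
    using that
  proof (induction n rule: less_induct)
    case (less n)
    show ?case
    proof (cases "n < ?a")
      case True
      then have "\<not> (n > 0 \<and> m dvd kfib K n)"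
        using not_less_Least unfolding kfib_rank_def by blast
      then show ?thesis using less.prems by simp
    next
      case False
      have "m dvd kfib K (n - ?a) * kfib K (Suc ?a)"
        using kfib_add_cong[OF a(2), of "n - ?a"] False less.prems by (simp add: cong_dvd_iff)
      then have "m dvd kfib K (n - ?a)"
        using coprime_kfib_Suc[OF a(2)] by (simp add: coprime_commute coprime_dvd_mult_left_iff)
      then have "?a dvd n - ?a" using less.IH[of "n - ?a"] a(1) False by simp
      then show ?thesis using False by (simp add: dvd_minus_self)
    qed
  qed
  show "m dvd kfib K n" if "?a dvd n"
    using that kfib_mult_Suc_cong[OF a(2)] by (auto simp: mult.commute elim: dvdE)
qed

lemma kfib_period_iff:
  "(\<forall>n. [kfib K (n + p) = kfib K n] (mod m)) \<longleftrightarrow> m dvd kfib K p \<and> [kfib K (Suc p) = 1] (mod m)"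
proof
  assume *: "\<forall>n. [kfib K (n + p) = kfib K n] (mod m)"
  show "m dvd kfib K p \<and> [kfib K (Suc p) = 1] (mod m)"
    using spec[OF *, of 0] spec[OF *, of "Suc 0"] by (simp add: cong_0_iff)
next
  assume *: "m dvd kfib K p \<and> [kfib K (Suc p) = 1] (mod m)"
  show "\<forall>n. [kfib K (n + p) = kfib K n] (mod m)"
  proof
    fix n
    have "[kfib K (n + p) = kfib K n * kfib K (Suc p)] (mod m)"
      using * by (intro kfib_add_cong) (rule conjunct1)
    also have "[kfib K n * kfib K (Suc p) = kfib K n * 1] (mod m)"
      using * by (intro cong_scalar_left) (rule conjunct2)
    finally show "[kfib K (n + p) = kfib K n] (mod m)" by simp
  qed
qed

lemma kfib_period_eq_rank_times_order:
  fixes K m :: int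
  assumes "m > 1"
  obtains w where "w > 0" "kfib_period K m = kfib_rank K m * w" "kfib_zeros K m = w"
    "[kfib K (Suc (kfib_rank K m)) ^ w = 1] (mod m)"
    "\<And>j. 0 < j \<Longrightarrow> [kfib K (Suc (kfib_rank K m)) ^ j = 1] (mod m) \<Longrightarrow> w \<le> j"
proof -
  let ?a = "kfib_rank K m" and ?p = "kfib_period K m"
  let ?c = "kfib K (Suc ?a)"
  let ?P = "\<lambda>p. p > 0 \<and> (\<forall>n. [kfib K (n + p) = kfib K n] (mod m))"
  have a: "?a > 0" "m dvd kfib K ?a" using kfib_rank[OF assms] by auto
  have P_iff: "?P (?a * j) \<longleftrightarrow> j > 0 \<and> [?c ^ j = 1] (mod m)" for j
  proof -
    have "[kfib K (Suc (?a * j)) = ?c ^ j] (mod m)" "m dvd kfib K (?a * j)"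
      using kfib_mult_Suc_cong[OF a(2), of j] by (simp_all add: mult.commute)
    then show ?thesis using a(1) unfolding kfib_period_iff
      by (meson cong_sym cong_trans nat_0_less_mult_iff)
  qed
  \<comment> \<open>Squaring removes the sign in Cassini's identity. Hence four times the rank is a
    period, which shows that the minimum defining \<open>kfib_period\<close> is attained.\<close>
  have "[(?c\<^sup>2)\<^sup>2 = ((- 1) ^ ?a)\<^sup>2] (mod m)"
    using kfib_Suc_square_cong[OF a(2)] by (rule cong_pow)
  then have "[?c ^ 4 = 1] (mod m)" by (simp flip: power_mult power_mult_distrib)
  then have "?P (?a * 4)" using P_iff[of 4] zero_less_numeral by blast
  then have p: "?P ?p" unfolding kfib_period_def by (rule LeastI)
  then have "?a dvd ?p" using kfib_period_iff dvd_kfib_iff[OF assms] by blast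
  then obtain w where w: "?p = ?a * w" ..
  have 1: "w > 0" "[?c ^ w = 1] (mod m)" using p P_iff[of w] w by auto
  have 2: "w \<le> j" if "0 < j" "[?c ^ j = 1] (mod m)" for j
  proof -
    have "?p \<le> ?a * j" unfolding kfib_period_def
      by (rule Least_le) (use P_iff that in blast)
    then show ?thesis using w a by simp
  qed
  have "{n. n < ?p \<and> m dvd kfib K n} = (\<lambda>i. ?a * i) ` {..<w}"
    using a(1) by (auto simp: dvd_kfib_iff[OF assms] w)
  then have "kfib_zeros K m = w"
    unfolding kfib_zeros_def using a(1) by (simp add: card_image inj_on_def)
  then show thesis using that w 1 2 by blast
qed

lemma not_cong_1_kfib_Suc_rank:
  fixes K m :: int
  assumes "odd K" "m > 1" "4 dvd kfib_rank K m"
  shows "\<not> [kfib K (Suc (kfib_rank K m)) = 1] (mod m)"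
proof
  assume c: "[kfib K (Suc (kfib_rank K m)) = 1] (mod m)"
  obtain i where i: "kfib_rank K m = 4 * i" using assms(3) by auto
  \<comment> \<open>Half the rank; being even, it makes the sign in Cassini's identity +1.\<close>
  define k where "k = 2 * i"
  define x where "x = kfib K k"
  define y where "y = kfib K (Suc k)"
  define D where "D = K\<^sup>2 + 4"
  have k: "kfib_rank K m = k + k" "even k" using i by (auto simp: k_def)
  have cas: "y\<^sup>2 - K * x * y - x\<^sup>2 = 1"
    using kfib_cassini[of K k] k by (simp add: x_def y_def)
  \<comment> \<open>Here \<open>2 * y - K * x\<close> is the companion Lucas number of index k, and
    \<open>K * y + 2 * x\<close> below is the one of index k + 1.\<close>
  have "kfib K (k + k) = x * (2 * y - K * x)"
    by (simp only: kfib_add x_def y_def) (simp add: algebra_simps)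
  then have d1: "m dvd x * (2 * y - K * x)"
    using kfib_rank(2)[OF assms(2), of K] k by simp
  have "kfib K (Suc (k + k)) = y\<^sup>2 + x\<^sup>2"
    using kfib_add[of K "Suc k" k] by (simp add: x_def y_def power2_eq_square algebra_simps)
  also have "\<dots> = x * (K * y + 2 * x) + 1"
    using cas by (simp add: power2_eq_square algebra_simps)
  finally have d2: "m dvd x * (K * y + 2 * x)"
    using c k by (simp add: cong_iff_dvd_diff)
  \<comment> \<open>Solving the two Lucas expressions for x and y introduces the determinant
    D.\<close>
  have "D * x * x = 2 * (x * (K * y + 2 * x)) - K * (x * (2 * y - K * x))"
    by (simp add: D_def power2_eq_square algebra_simps)
  then have d3: "m dvd D * x * x" using d1 d2 by simp
  have "D * x * y = K * (x * (K * y + 2 * x)) + 2 * (x * (2 * y - K * x))"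
    by (simp add: D_def power2_eq_square algebra_simps)
  then have d4: "m dvd D * x * y" using d1 d2 by simp
  \<comment> \<open>Cassini's identity serves as a Bezout relation between x and y, which strips the
    second factor.\<close>
  have "D * x = D * x * (y\<^sup>2 - K * x * y - x\<^sup>2)" using cas by simp
  also have "\<dots> = (D * x * y) * (y - K * x) - (D * x * x) * x"
    by (simp add: power2_eq_square algebra_simps)
  finally have d5: "m dvd D * x" using d3 d4 by (metis dvd_diff dvd_mult2)
  \<comment> \<open>This is \<open>(2 * y - K * x)\<^sup>2 = D * x\<^sup>2 + 4\<close> multiplied by
    x.\<close>
  have "4 * x = 4 * x * (y\<^sup>2 - K * x * y - x\<^sup>2)" using cas by simp
  also have "\<dots> = x * (2 * y - K * x) * (2 * y - K * x) - (D * x * x) * x"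
    by (simp add: D_def power2_eq_square algebra_simps)
  finally have d6: "m dvd 4 * x" using d1 d3 by (metis dvd_diff dvd_mult2)
  obtain s where s: "K = 2 * s + 1" using assms(1) by (elim oddE)
  \<comment> \<open>For odd K, D = 4 * (s^2 + s + 1) + 1, so D and 4 are coprime.\<close>
  have "x = D * x - (s\<^sup>2 + s + 1) * (4 * x)"
    by (simp add: D_def s power2_eq_square algebra_simps)
  then have "m dvd x" using d5 d6 by (metis dvd_diff dvd_mult)
  then have "kfib_rank K m dvd k" using dvd_kfib_iff[OF assms(2)] x_def by simp
  then show False using k kfib_rank(1)[OF assms(2), of K] by (auto dest: dvd_imp_le)
qed

theorem theorem4p26:
  fixes K m :: int
  assumes "odd K" and "m > 1"
  shows "(m > 3 \<longrightarrow>
           (kfib_zeros K m = 4 \<longleftrightarrow>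
              [int (kfib_rank K m) = 1] (mod 4) \<or> [int (kfib_rank K m) = - 1] (mod 4)))
       \<and> (kfib_zeros K m = 2 \<longleftrightarrow> 4 dvd kfib_period K m \<and> 2 dvd kfib_rank K m)
       \<and> (kfib_zeros K m = 1 \<longleftrightarrow> \<not> 4 dvd kfib_period K m)"
proof -
  let ?a = "kfib_rank K m"
  let ?c = "kfib K (Suc ?a)"
  obtain w where w: "w > 0" "kfib_period K m = ?a * w" "kfib_zeros K m = w"
    "[?c ^ w = 1] (mod m)" "\<And>j. 0 < j \<Longrightarrow> [?c ^ j = 1] (mod m) \<Longrightarrow> w \<le> j"
    using kfib_period_eq_rank_times_order[OF assms(2)] by blast
  have sq: "[?c\<^sup>2 = (- 1) ^ ?a] (mod m)"
    using kfib_rank[OF assms(2)] kfib_Suc_square_cong by blast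
  have odd_iff: "[int ?a = 1] (mod 4) \<or> [int ?a = - 1] (mod 4) \<longleftrightarrow> odd ?a"
  proof -
    have "[x = 1] (mod 4) \<or> [x = - 1] (mod 4) \<longleftrightarrow> odd x" for x :: int
    proof -
      have "x mod 4 = 1 \<or> x mod 4 = 3 \<longleftrightarrow> odd x" by presburger
      then show ?thesis by (simp add: cong_def)
    qed
    then show ?thesis by (simp only: even_of_nat)
  qed
  show ?thesis
  proof (cases "even ?a")
    case True
    then have "w \<le> 2" using sq w(5)[of 2] by simp
    then consider "w = 1" | "w = 2" using w(1) by linarith
    then show ?thesis
    proof cases
      case 1
      \<comment> \<open>With w = 1 the period equals the rank, so this is the required statement
        about the period.\<close>
      then have "\<not> 4 dvd ?a"
        using w(4) not_cong_1_kfib_Suc_rank[OF assms] by auto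
      then show ?thesis unfolding odd_iff w(2,3) using 1 True by simp
    next
      case 2
      moreover have "4 dvd ?a * 2" using True mult_dvd_mono[of 2 ?a 2 2] by simp
      ultimately show ?thesis unfolding odd_iff w(2,3) using True by simp
    qed
  next
    case False
    then have sq': "[?c\<^sup>2 = - 1] (mod m)" using sq by simp
    show ?thesis
    \<comment> \<open>Modulo 2 the residues 1 and -1 coincide, so an odd rank gives order 1 there
      instead of 4.\<close>
    proof (cases "m = 2")
      case True
      then have "[?c = 1] (mod m)"
        using coprime_kfib_Suc[OF kfib_rank(2)[OF assms(2)], of K] by (simp add: cong_def odd_iff_mod_2_eq_one)
      then have "w = 1" using w(1) w(5)[of 1] by simp
      moreover have "\<not> 4 dvd ?a" using False dvd_trans[of 2 4 ?a] by auto
      ultimately show ?thesis unfolding odd_iff w(2,3) using True by simp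
    next
      case m2: False
      have ne: "\<not> [- 1 = 1] (mod m)"
      proof
        assume "[- 1 = 1] (mod m)"
        then have "m dvd 2" by (simp add: cong_iff_dvd_diff)
        then show False using m2 assms(2) by (auto dest: zdvd_imp_le)
      qed
      have c2: "\<not> [?c ^ 2 = 1] (mod m)"
        using sq' ne cong_sym cong_trans by blast
      have c1: "\<not> [?c ^ 1 = 1] (mod m)"
        using c2 cong_pow[of "?c" 1 m 2] by auto
      have c4: "[?c ^ 4 = 1] (mod m)"
        using cong_pow[OF sq', of 2] by (simp flip: power_mult)
      have c3: "\<not> [?c ^ 3 = 1] (mod m)"
      proof
        assume c3: "[?c ^ 3 = 1] (mod m)"
        have "[?c * ?c ^ 3 = ?c * 1] (mod m)" using c3 by (rule cong_scalar_left)
        then have "[?c ^ 4 = ?c] (mod m)" by (simp add: eval_nat_numeral)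
        then show False using c4 c1 cong_sym cong_trans unfolding power_one_right by blast
      qed
      have "w \<le> 4" using w(5)[of 4] c4 by simp
      moreover have "w \<noteq> 1" "w \<noteq> 2" "w \<noteq> 3" using w(4) c1 c2 c3 by auto
      ultimately have "w = 4" using w(1) by linarith
      then show ?thesis unfolding odd_iff w(2,3) using False by simp
    qed
  qed
qed

end
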